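(* Let $G$ be a torsion-free abelian group. If any one of the following conditions holds, then $G$ is Bassian-finite: (a) $G$ has finite rank. (b) $G$ is indecomposable. (c) $G$ is co-Hopfian.
   Context: All groups are abelian, written additively. A group $G$ is Bassian-finite if there is no monomorphism from $G$ to any proper direct summand of $G$ (a direct summand different from $G$). A group $G$ is co-Hopfian if it is not isomorphic to any of its proper subgroups (equivalently, every injective endomorphism of $G$ is surjective). A group is indecomposable if it cannot be written as $A\oplus B$ with $A\neq\{0\}\neq B$. The rank of a torsion-free group is the size of a maximal $\mathbb{Z}$-linearly independent subset. *)

theory Defs
  imports "HOL-Algebra.Algebra"
begin

text \<open>
  Abelian groups are \<^locale>\<open>comm_group\<close> structures, hence written multiplicatively:
  \<open>A <#> B\<close> is the sum \<open>A + B\<close> of subgroups, and \<open>x [^] n\<close> is the multiple \<open>n x\<close>.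
\<close>

definition torsion_free_group :: "('a, 'b) monoid_scheme \<Rightarrow> bool" where
  "torsion_free_group G \<longleftrightarrow>
     (\<forall>x\<in>carrier G. \<forall>n::nat. n > 0 \<longrightarrow> x [^]\<^bsub>G\<^esub> n = \<one>\<^bsub>G\<^esub> \<longrightarrow> x = \<one>\<^bsub>G\<^esub>)"

definition internal_direct_sum :: "('a, 'b) monoid_scheme \<Rightarrow> 'a set \<Rightarrow> 'a set \<Rightarrow> bool" where
  "internal_direct_sum G A B \<longleftrightarrow>
     subgroup A G \<and> subgroup B G \<and> A <#>\<^bsub>G\<^esub> B = carrier G \<and> A \<inter> B = {\<one>\<^bsub>G\<^esub>}"

definition direct_summand :: "('a, 'b) monoid_scheme \<Rightarrow> 'a set \<Rightarrow> bool" where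
  "direct_summand G A \<longleftrightarrow> (\<exists>B. internal_direct_sum G A B)"

definition Bassian_finite :: "('a, 'b) monoid_scheme \<Rightarrow> bool" where
  "Bassian_finite G \<longleftrightarrow>
     \<not> (\<exists>A. direct_summand G A \<and> A \<noteq> carrier G \<and> (\<exists>f. f \<in> mon G (G\<lparr>carrier := A\<rparr>)))"

definition co_Hopfian :: "('a, 'b) monoid_scheme \<Rightarrow> bool" where
  "co_Hopfian G \<longleftrightarrow>
     \<not> (\<exists>H. subgroup H G \<and> H \<noteq> carrier G \<and> G \<cong> G\<lparr>carrier := H\<rparr>)"

text \<open>As in the source, the trivial group counts as indecomposable.\<close>

definition indecomposable :: "('a, 'b) monoid_scheme \<Rightarrow> bool" where
  "indecomposable G \<longleftrightarrow>
     \<not> (\<exists>A B. internal_direct_sum G A B \<and> A \<noteq> {\<one>\<^bsub>G\<^esub>} \<and> B \<noteq> {\<one>\<^bsub>G\<^esub>})"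

definition int_independent :: "('a, 'b) monoid_scheme \<Rightarrow> 'a set \<Rightarrow> bool" where
  "int_independent G S \<longleftrightarrow> S \<subseteq> carrier G \<and>
     (\<forall>F (c :: 'a \<Rightarrow> int). finite F \<and> F \<subseteq> S \<and> finprod G (\<lambda>x. x [^]\<^bsub>G\<^esub> c x) F = \<one>\<^bsub>G\<^esub>
        \<longrightarrow> (\<forall>x\<in>F. c x = 0))"

definition maximal_int_independent :: "('a, 'b) monoid_scheme \<Rightarrow> 'a set \<Rightarrow> bool" where
  "maximal_int_independent G S \<longleftrightarrow>
     int_independent G S \<and> (\<forall>T. int_independent G T \<and> S \<subseteq> T \<longrightarrow> T = S)"

text \<open>
  The rank is the size of any maximal independent subset; all of these have the same size,
  so finite rank means that some such subset is finite.
\<close>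

definition finite_rank :: "('a, 'b) monoid_scheme \<Rightarrow> bool" where
  "finite_rank G \<longleftrightarrow> (\<exists>S. maximal_int_independent G S \<and> finite S)"

end

theory Submission
  imports Defs
begin

text \<open>
  A monomorphism \<open>f\<close> of \<open>G\<close> into a proper summand \<open>A\<close> exhibits \<open>G\<close> as isomorphic to the proper
  subgroup \<open>f ` G\<close>, so \<open>G\<close> is not co-Hopfian; and if \<open>G\<close> is indecomposable, then \<open>A\<close> is trivial,
  hence so is \<open>G\<close>. For finite rank, take \<open>b \<noteq> 0\<close> in a complement \<open>B\<close> of \<open>A\<close>. In a relation
  \<open>c\<^sub>0 b + c\<^sub>1 f b + \<dots> + c\<^sub>n f\<^sup>n b = 0\<close> all terms but the first lie in \<open>A\<close>, so \<open>c\<^sub>0 b = 0\<close> and \<open>c\<^sub>0 = 0\<close>;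
  cancelling \<open>f\<close> leaves a shorter relation. Hence the iterates of \<open>b\<close> are independent, whereas in a
  group with a maximal independent set of \<open>n\<close> elements any \<open>n + 1\<close> elements are dependent.
\<close>

text \<open>Gaussian elimination, by induction on the set of equations \<open>J\<close>.
  Cross-multiplying instead of dividing by the pivot keeps everything inside an integral domain, so
  it applies to integer coefficients directly.\<close>

lemma homogeneous_system_nontrivial_solution:
  fixes a :: "'i \<Rightarrow> 'j \<Rightarrow> 'r::idom"
  assumes "finite J" "finite I" "card J < card I"
  shows "\<exists>c. (\<exists>i\<in>I. c i \<noteq> 0) \<and> (\<forall>j\<in>J. (\<Sum>i\<in>I. c i * a i j) = 0)"
  using assms
proof (induction J arbitrary: I a rule: finite_induct)
  case empty
  then have "I \<noteq> {}" by auto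
  then show ?case by (intro exI[of _ "\<lambda>_. 1"]) auto
next
  case (insert j J)
  show ?case
  proof (cases "\<forall>i\<in>I. a i j = 0")
    case True
    moreover obtain c where "\<exists>i\<in>I. c i \<noteq> 0" "\<forall>k\<in>J. (\<Sum>i\<in>I. c i * a i k) = 0"
      using insert.IH[of I a] insert.prems insert.hyps by auto
    ultimately show ?thesis by auto
  next
    case False
    then obtain p where p: "p \<in> I" "a p j \<noteq> 0" by auto
    define I' where "I' = I - {p}"
    have I': "finite I'" "p \<notin> I'" "I = insert p I'"
      using insert.prems p by (auto simp: I'_def)
    then have "card J < card I'"
      using insert.prems insert.hyps by simp
    \<comment> \<open>Equation \<open>j\<close> times \<open>a p k\<close> is subtracted from
      equation \<open>k\<close> times the pivot \<open>a p j\<close>; this eliminates the unknown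
      \<open>p\<close>.\<close>
    then obtain c where c: "\<exists>i\<in>I'. c i \<noteq> 0"
      "\<forall>k\<in>J. (\<Sum>i\<in>I'. c i * (a p j * a i k - a i j * a p k)) = 0"
      using insert.IH[of I' "\<lambda>i k. a p j * a i k - a i j * a p k"] I' by blast
    \<comment> \<open>Back substitution: the other unknowns are scaled by the pivot, and
      \<open>d p\<close> is what equation \<open>j\<close> then forces.\<close>
    define d where "d i = (if i = p then - (\<Sum>i\<in>I'. c i * a i j) else c i * a p j)" for i
    have sum_d: "(\<Sum>i\<in>I. d i * a i k) = (\<Sum>i\<in>I'. c i * (a p j * a i k - a i j * a p k))" for k
    proof -
      have "(\<Sum>i\<in>I'. d i * a i k) = (\<Sum>i\<in>I'. c i * a p j * a i k)"
        using I' by (intro sum.cong) (auto simp: d_def)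
      moreover have "d p * a p k = - (\<Sum>i\<in>I'. c i * (a i j * a p k))"
        by (simp add: d_def sum_distrib_right mult.assoc)
      ultimately show ?thesis
        using I' by (simp add: right_diff_distrib sum_subtractf mult.assoc)
    qed
    have "(\<Sum>i\<in>I'. c i * (a p j * a i j - a i j * a p j)) = 0"
      by (intro sum.neutral) (simp add: mult.commute)
    then have "(\<Sum>i\<in>I. d i * a i k) = 0" if "k \<in> insert j J" for k
      using that c(2) unfolding sum_d by blast
    \<comment> \<open>Scaling by the nonzero pivot cannot annihilate a nonzero \<open>c i\<close>,
      as there are no zero divisors.\<close>
    moreover have "\<exists>i\<in>I. d i \<noteq> 0"
    proof -
      obtain i where "i \<in> I'" "c i \<noteq> 0"
        using c(1) by blast
      then have "i \<in> I" "d i \<noteq> 0"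
        using p I'(2,3) by (auto simp: d_def)
      then show ?thesis by blast
    qed
    ultimately show ?thesis by blast
  qed
qed

lemma (in comm_group) hom_finprod:
  assumes "comm_group H" "h \<in> hom G H" "f \<in> A \<rightarrow> carrier G"
  shows "h (finprod G f A) = finprod H (\<lambda>x. h (f x)) A"
proof -
  interpret H: comm_group H by fact
  interpret group_hom G H h
    by (simp add: group_hom_def group_hom_axioms_def assms is_group)
  show ?thesis
    using assms(3) by (induction A rule: infinite_finite_induct) (auto simp: Pi_def)
qed

lemma (in comm_group) finprod_int_pow:
  assumes "f \<in> A \<rightarrow> carrier G"
  shows "finprod G f A [^] (k::int) = finprod G (\<lambda>x. f x [^] k) A"
  by (rule hom_finprod[OF comm_group_axioms _ assms])
     (auto simp: hom_def int_pow_distrib)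

text \<open>Interchange of the two products. It turns a combination of combinations of
  \<open>S\<close> into a single one whose exponents are the left-hand sides of a linear
  system.\<close>

lemma (in comm_group) finprod_int_pow_sum:
  assumes "finite I" "s \<in> S \<rightarrow> carrier G"
  shows "finprod G (\<lambda>i. finprod G (\<lambda>x. s x [^] (e i x :: int)) S) I
       = finprod G (\<lambda>x. s x [^] (\<Sum>i\<in>I. e i x)) S"
  using assms(1)
proof (induction I rule: finite_induct)
  case empty
  then show ?case by simp
next
  case (insert i I)
  have "finprod G (\<lambda>x. s x [^] (\<Sum>k\<in>insert i I. e k x)) S
      = finprod G (\<lambda>x. s x [^] e i x \<otimes> s x [^] (\<Sum>k\<in>I. e k x)) S"
    using insert assms(2) by (intro finprod_cong') (auto simp: int_pow_mult Pi_def)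
  then show ?case
    using insert assms(2) by (simp add: Pi_def)
qed

text \<open>For \<open>x\<close> outside \<open>S\<close>, maximality makes
  \<open>insert x S\<close> dependent, and a nontrivial relation must involve \<open>x\<close>
  because \<open>S\<close> itself is independent; it is then solved for a multiple of
  \<open>x\<close>.\<close>

lemma (in comm_group) maximal_int_independent_multiple:
  assumes S: "maximal_int_independent G S" "finite S" and x: "x \<in> carrier G"
  shows "\<exists>(m::int) a. m \<noteq> 0 \<and> x [^] m = finprod G (\<lambda>s. s [^] (a s :: int)) S"
proof (cases "x \<in> S")
  case True
  have SG: "S \<subseteq> carrier G"
    using S by (auto simp: maximal_int_independent_def int_independent_def)
  have "finprod G (\<lambda>s. s [^] (if s = x then 1 else 0 :: int)) S
      = finprod G (\<lambda>s. if s = x then s else \<one>) S"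
    using SG by (intro finprod_cong') auto
  also have "\<dots> = x"
    using True S SG by (intro finprod_singleton_swap) auto
  finally show ?thesis
    using x by (intro exI[of _ 1] exI[of _ "\<lambda>s. if s = x then 1 else 0"]) auto
next
  case False
  have SG: "S \<subseteq> carrier G" and ind: "int_independent G S"
    using S by (auto simp: maximal_int_independent_def int_independent_def)
  have "\<not> int_independent G (insert x S)"
    using S False by (auto simp: maximal_int_independent_def)
  then obtain F and c :: "'a \<Rightarrow> int" where F: "finite F" "F \<subseteq> insert x S"
      "finprod G (\<lambda>s. s [^] c s) F = \<one>" and nz: "\<exists>s\<in>F. c s \<noteq> 0"
    using SG x by (auto simp: int_independent_def)
  \<comment> \<open>Extension of \<open>c\<close> by 0, so that the relation runs over all of
    \<open>insert x S\<close> and the factor of \<open>x\<close> can be split off.\<close>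
  define e where "e s = (if s \<in> F then c s else 0)" for s
  have eF: "finprod G (\<lambda>s. s [^] e s) (insert x S) = finprod G (\<lambda>s. s [^] c s) F"
    using F S SG x
    by (intro finprod_mono_neutral_cong_right) (auto simp: e_def)
  have rel: "x [^] e x \<otimes> finprod G (\<lambda>s. s [^] e s) S = \<one>"
    using eF F(3) False S SG x by (subst (asm) finprod_insert) (auto simp: Pi_def)
  have clo: "finprod G (\<lambda>s. s [^] k s) S \<in> carrier G" for k :: "'a \<Rightarrow> int"
    using SG by (intro finprod_closed) auto
  have "e x \<noteq> 0"
  proof
    assume ex: "e x = 0"
    then have "finprod G (\<lambda>s. s [^] e s) S = \<one>"
      using rel clo by simp
    then have "\<forall>s\<in>S. e s = 0"
      using ind S(2) unfolding int_independent_def by blast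
    then show False
      using nz ex F(2) by (auto simp: e_def split: if_splits)
  qed
  moreover have "x [^] (- e x) = finprod G (\<lambda>s. s [^] e s) S"
    using rel clo x by (metis int_pow_closed int_pow_neg inv_equality m_comm)
  ultimately show ?thesis
    by (intro exI[of _ "- e x"] exI[of _ e]) simp
qed

text \<open>Suitable multiples of the \<open>b i\<close> are combinations of \<open>S\<close>;
  making a combination of these multiples vanish amounts to \<open>card S\<close> equations in
  \<open>card I\<close> unknowns. With an indexed family, the iterates of \<open>b\<close> need not
  be known to be distinct.\<close>

lemma (in comm_group) maximal_int_independent_imp_dependent:
  assumes S: "maximal_int_independent G S" "finite S"
    and I: "finite I" "card S < card I" and b: "b \<in> I \<rightarrow> carrier G"
  shows "\<exists>d. (\<exists>i\<in>I. d i \<noteq> 0) \<and> finprod G (\<lambda>i. b i [^] (d i :: int)) I = \<one>"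
proof -
  have SG: "S \<subseteq> carrier G"
    using S by (auto simp: maximal_int_independent_def int_independent_def)
  have "\<forall>i\<in>I. \<exists>(m::int) a. m \<noteq> 0 \<and> b i [^] m = finprod G (\<lambda>s. s [^] (a s :: int)) S"
    using maximal_int_independent_multiple[OF S] b by blast
  then obtain m :: "_ \<Rightarrow> int" and a where
    ma: "\<And>i. i \<in> I \<Longrightarrow> m i \<noteq> 0 \<and> b i [^] m i = finprod G (\<lambda>s. s [^] (a i s :: int)) S"
    by metis
  obtain c where c: "\<exists>i\<in>I. c i \<noteq> 0" "\<forall>s\<in>S. (\<Sum>i\<in>I. c i * a i s) = 0"
    using homogeneous_system_nontrivial_solution[OF S(2) I, of a] by blast
  have pow: "b i [^] (m i * c i) = finprod G (\<lambda>s. s [^] (c i * a i s)) S" if "i \<in> I" for i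
  proof -
    have "b i [^] (m i * c i) = (b i [^] m i) [^] c i"
      using that b by (subst int_pow_pow) auto
    also have "\<dots> = finprod G (\<lambda>s. (s [^] a i s) [^] c i) S"
      using ma[OF that] SG by (simp add: finprod_int_pow subset_iff Pi_def)
    also have "\<dots> = finprod G (\<lambda>s. s [^] (c i * a i s)) S"
      using SG by (intro finprod_cong') (auto simp: int_pow_pow mult.commute)
    finally show ?thesis .
  qed
  have "finprod G (\<lambda>i. b i [^] (m i * c i)) I
      = finprod G (\<lambda>i. finprod G (\<lambda>s. s [^] (c i * a i s)) S) I"
    using SG by (intro finprod_cong') (auto simp: pow intro!: finprod_closed)
  also have "\<dots> = finprod G (\<lambda>s. s [^] (\<Sum>i\<in>I. c i * a i s)) S"
    using I SG by (intro finprod_int_pow_sum) auto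
  also have "\<dots> = \<one>"
    using c(2) by (intro finprod_one_eqI) simp
  finally show ?thesis
    using c(1) ma by (intro exI[of _ "\<lambda>i. m i * c i"]) auto
qed

lemma (in group) torsion_free_int_pow:
  assumes "torsion_free_group G" "x \<in> carrier G" "x [^] (k::int) = \<one>" "x \<noteq> \<one>"
  shows "k = 0"
proof (rule ccontr)
  assume "k \<noteq> 0"
  then have pos: "0 < nat \<bar>k\<bar>" by simp
  have "x [^] nat \<bar>k\<bar> = x [^] \<bar>k\<bar>"
    by (rule pow_nat) simp
  also have "\<dots> = \<one>"
  proof (cases "k < 0")
    case True
    then have "x [^] \<bar>k\<bar> = x [^] (- k)" by simp
    then show ?thesis
      unfolding int_pow_neg[OF assms(2)] assms(3) by simp
  next
    case False
    then show ?thesis using assms(3) by simp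
  qed
  finally have "x [^] nat \<bar>k\<bar> = \<one>" .
  then show False
    using assms(1,2,4) pos unfolding torsion_free_group_def by blast
qed

lemma (in comm_group) iterates_independent:
  assumes tf: "torsion_free_group G" and AB: "internal_direct_sum G A B"
    and f: "f \<in> mon G (G\<lparr>carrier := A\<rparr>)" and b: "b \<in> B" "b \<noteq> \<one>"
    and rel: "finprod G (\<lambda>i. (f ^^ i) b [^] (d i :: int)) {..n} = \<one>" and i: "i \<le> n"
  shows "d i = 0"
proof -
  have A: "subgroup A G" and B: "subgroup B G" and disj: "A \<inter> B = {\<one>}"
    using AB by (auto simp: internal_direct_sum_def)
  have fA: "f x \<in> A" if "x \<in> carrier G" for x
    using f that by (auto simp: mon_def hom_def)
  have fhom: "f \<in> hom G G" and finj: "inj_on f (carrier G)"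
    using f subgroup.subset[OF A] by (auto simp: mon_def hom_def)
  interpret f: group_hom G G f
    by (simp add: group_hom_def group_hom_axioms_def fhom)
  have bG: "b \<in> carrier G"
    using b B subgroup.subset by blast
  have it [simp]: "(f ^^ k) b \<in> carrier G" for k
    by (induction k) (auto simp: bG)
  \<comment> \<open>The multiple of \<open>b\<close> also lies in \<open>B\<close>, hence in
    \<open>A \<inter> B\<close>, so it is trivial and torsion-freeness applies. The claim is for
    every \<open>d\<close>, since the induction below changes the coefficients.\<close>
  have head: "d 0 = 0" if "b [^] d 0 \<in> A" for d :: "nat \<Rightarrow> int"
    using that disj subgroup_int_pow_closed[OF B b(1)] torsion_free_int_pow[OF tf bG _ b(2)]
    by blast
  show ?thesis
    using rel i
  proof (induction n arbitrary: d i)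
    case 0
    then show ?case
      using head[of d] subgroup.one_closed[OF A] bG by auto
  next
    case (Suc n)
    \<comment> \<open>\<open>p\<close> is the tail of the relation with one application of
      \<open>f\<close> removed, so \<open>f p\<close> is the tail itself.\<close>
    define p where "p = finprod G (\<lambda>i. (f ^^ i) b [^] d (Suc i)) {..n}"
    have p: "p \<in> carrier G"
      unfolding p_def by (intro finprod_closed) auto
    have "f p = finprod G (\<lambda>i. (f ^^ Suc i) b [^] d (Suc i)) {..n}"
      unfolding p_def by (subst hom_finprod[OF comm_group_axioms fhom]) (auto simp: f.hom_int_pow)
    then have eq: "f p \<otimes> b [^] d 0 = \<one>"
      using Suc.prems(1) by (subst (asm) finprod_Suc2) (auto simp del: funpow.simps(2))
    then have "b [^] d 0 = inv (f p)"
      using p bG by (metis f.hom_closed int_pow_closed inv_equality m_comm)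
    then have d0: "d 0 = 0"
      using head[of d] subgroup.m_inv_closed[OF A fA[OF p]] by simp
    then have "f p = f \<one>"
      using eq p bG by simp
    then have "p = \<one>"
      using inj_onD[OF finj, of p \<one>] p by simp
    \<comment> \<open>\<open>p = \<one>\<close> is a relation of length \<open>n\<close> for the
      shifted coefficients, which covers \<open>i > 0\<close>; \<open>d0\<close> covers
      \<open>i = 0\<close>.\<close>
    then show ?case
      using Suc.IH[of "\<lambda>i. d (Suc i)" "i - 1"] Suc.prems(2) d0 p_def by (cases i) auto
  qed
qed

lemma (in group) internal_direct_sum_trivial_right:
  assumes "internal_direct_sum G A {\<one>}"
  shows "A = carrier G"
proof -
  have "A <#> {\<one>} = carrier G" "A \<subseteq> carrier G"
    using assms by (auto simp: internal_direct_sum_def dest: subgroup.subset)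
  then show ?thesis
    by (auto simp: set_mult_def subset_iff)
qed

theorem proposition2p4:
  fixes G :: "('a, 'b) monoid_scheme"
  assumes "comm_group G"
    and "torsion_free_group G"
    and "finite_rank G \<or> indecomposable G \<or> co_Hopfian G"
  shows "Bassian_finite G"
  unfolding Bassian_finite_def
proof
  interpret comm_group G by fact
  assume "\<exists>A. direct_summand G A \<and> A \<noteq> carrier G \<and> (\<exists>f. f \<in> mon G (G\<lparr>carrier := A\<rparr>))"
  then obtain A B f where AB: "internal_direct_sum G A B" and proper: "A \<noteq> carrier G"
    and f: "f \<in> mon G (G\<lparr>carrier := A\<rparr>)"
    by (auto simp: direct_summand_def)
  have A: "subgroup A G" and B: "subgroup B G"
    using AB by (auto simp: internal_direct_sum_def)
  have fA: "f ` carrier G \<subseteq> A" and finj: "inj_on f (carrier G)"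
    using f by (auto simp: mon_def hom_def)
  have fhom: "f \<in> hom G G"
    using f subgroup.subset[OF A] by (auto simp: mon_def hom_def)
  have nontrivial: "B \<noteq> {\<one>\<^bsub>G\<^esub>}"
    using internal_direct_sum_trivial_right AB proper by blast
  from assms(3) show False
  proof (elim disjE)
    assume "finite_rank G"
    then obtain S where S: "maximal_int_independent G S" "finite S"
      by (auto simp: finite_rank_def)
    obtain b where b: "b \<in> B" "b \<noteq> \<one>\<^bsub>G\<^esub>"
      using nontrivial subgroup.one_closed[OF B] by blast
    have it: "(f ^^ k) b \<in> carrier G" for k
      using b subgroup.subset[OF B] fhom by (induction k) (auto simp: hom_def)
    \<comment> \<open>The index set \<open>{..card S}\<close> starts at 0 and so has
      \<open>card S + 1\<close> elements, one more than \<open>S\<close>.\<close>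
    obtain d :: "nat \<Rightarrow> int" where "\<exists>i\<in>{..card S}. d i \<noteq> 0"
        "finprod G (\<lambda>i. (f ^^ i) b [^]\<^bsub>G\<^esub> d i) {..card S} = \<one>\<^bsub>G\<^esub>"
      using maximal_int_independent_imp_dependent[OF S, of "{..card S}" "\<lambda>i. (f ^^ i) b"] it
      by auto
    then show False
      using iterates_independent[OF assms(2) AB f b] by blast
  next
    assume "indecomposable G"
    then have "A = {\<one>\<^bsub>G\<^esub>}"
      using AB nontrivial by (auto simp: indecomposable_def)
    \<comment> \<open>\<open>f\<close> is injective on the carrier and takes values in a one-element
      set.\<close>
    then have "carrier G \<subseteq> {\<one>\<^bsub>G\<^esub>}"
      using fA finj by (auto simp: inj_on_def image_subset_iff)
    then show False
      using proper \<open>A = {\<one>\<^bsub>G\<^esub>}\<close> by auto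
  next
    assume "co_Hopfian G"
    interpret f: group_hom G G f
      by (simp add: group_hom_def group_hom_axioms_def fhom)
    have "f \<in> iso G (G\<lparr>carrier := f ` carrier G\<rparr>)"
      using fhom finj by (auto simp: iso_def hom_def bij_betw_def)
    then have "G \<cong> G\<lparr>carrier := f ` carrier G\<rparr>"
      by (auto simp: is_iso_def)
    moreover have "f ` carrier G \<noteq> carrier G"
      using fA proper subgroup.subset[OF A] by auto
    ultimately show False
      using \<open>co_Hopfian G\<close> f.img_is_subgroup by (auto simp: co_Hopfian_def)
  qed
qed

end
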